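(* Let $\xi:\Omega\to(-\infty,\infty]$ be bounded from below. Then, for almost all $\omega\in\Omega$, $$\liminf_{n\to\infty}\overline{\mathbb E}(\xi\mid\omega^n)\ge\xi(\omega).$$
   Context: Conventions: $\mathbb N=\{1,2,\ldots\}$, $\overline{\mathbb R}=[-\infty,\infty]$, $0\times\infty:=0$ and $\infty+(-\infty):=\infty$. $\mathbb I_E$ denotes the indicator function of $E$. For a non-empty set $X$, an outer probability content on $X$ is a function $\mathcal E:\overline{\mathbb R}^X\to\overline{\mathbb R}$ such that: (1) $f\le g$ implies $\mathcal E(f)\le\mathcal E(g)$; (2) $\mathcal E(cf)=c\,\mathcal E(f)$ for all $f$ and $c\in(0,\infty)$; (3) $\mathcal E(f+g)\le\mathcal E(f)+\mathcal E(g)$ for all $f,g$; (4) $\mathcal E(c)=c$ for every $c\in\mathbb R$ (the argument being the constant function $c$). Setting: a non-empty set $\mathcal X$ and outer probability contents $\mathcal E_1,\mathcal E_2,\ldots$ on $\mathcal X$ are fixed. The sample space is $\Omega:=\mathcal X^\infty$ (infinite sequences); situations are elements of $\mathcal X^*:=\bigcup_{n\ge0}\mathcal X^n$; $\Box$ is the empty situation. For a situation $s$, $\Gamma(s)\subseteq\Omega$ is the set of infinite sequences having $s$ as a prefix; $sx$ is $s$ with $x\in\mathcal X$ appended. For $\omega\in\Omega$ and $n\ge0$, $\omega^n$ is the prefix of $\omega$ of length $n$. A supermartingale is a function $\mathcal S:\mathcal X^*\to\overline{\mathbb R}$ such that $\mathcal E_n(\mathcal S(s\,\cdot))\le\mathcal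 S(s)$ for all $n\in\mathbb N$ and $s\in\mathcal X^{n-1}$, where $\mathcal S(s\,\cdot)$ is the function $x\mapsto\mathcal S(sx)$. It is bounded below if $\inf\mathcal S>-\infty$. For $\xi:\Omega\to\overline{\mathbb R}$ and a situation $s$, the upper expectation is $$\overline{\mathbb E}(\xi\mid s):=\inf\bigl\{\mathcal S(s)\bigm|\liminf_{n\to\infty}\mathcal S(\omega^n)\ge\xi(\omega)\text{ for all }\omega\in\Gamma(s)\bigr\},$$ $\mathcal S$ ranging over the supermartingales that are bounded below; the lower expectation is $\underline{\mathbb E}(\xi\mid s):=-\overline{\mathbb E}(-\xi\mid s)$. For $E\subseteq\Omega$, $\overline{\mathbb P}(E\mid s):=\overline{\mathbb E}(\mathbb I_E\mid s)$, $\underline{\mathbb P}(E\mid s):=\underline{\mathbb E}(\mathbb I_E\mid s)$; $\overline{\mathbb P}(E):=\overline{\mathbb P}(E\mid\Box)$ and $\underline{\mathbb P}(E):=\underline{\mathbb P}(E\mid\Box)$. A property $E\subseteq\Omega$ holds for almost all $\omega$ if $\underline{\mathbb P}(E)=1$. *)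

theory Defs
  imports "HOL-Library.Extended_Real" "HOL-Library.Liminf_Limsup"
    "HOL-Library.Indicator_Function" "HOL-Library.Stream"
begin

text \<open>The arithmetic conventions needed here, namely that zero times infinity is zero and that
  infinity plus minus infinity is plus infinity (in either order), are those of the
  type \<^typ>\<open>ereal\<close>.\<close>

definition outer_prob_content :: "(('x \<Rightarrow> ereal) \<Rightarrow> ereal) \<Rightarrow> bool" where
  "outer_prob_content \<E> \<longleftrightarrow>
     (\<forall>f g. (\<forall>x. f x \<le> g x) \<longrightarrow> \<E> f \<le> \<E> g) \<and>
     (\<forall>f (c::real). 0 < c \<longrightarrow> \<E> (\<lambda>x. ereal c * f x) = ereal c * \<E> f) \<and>
     (\<forall>f g. \<E> (\<lambda>x. f x + g x) \<le> \<E> f + \<E> g) \<and>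
     (\<forall>c::real. \<E> (\<lambda>x. ereal c) = ereal c)"

text \<open>The set of outcomes is the (automatically non-empty) type \<^typ>\<open>'x\<close>; situations are finite
  lists and the sample space is the type of streams. The prefix of \<^term>\<open>\<omega>\<close> of length \<^term>\<open>n\<close>
  is \<^term>\<open>stake n \<omega>\<close>.\<close>

definition cylinder :: "'x list \<Rightarrow> 'x stream set" where
  "cylinder s = {\<omega>. stake (length s) \<omega> = s}"

text \<open>Contents are numbered from 1: \<^term>\<open>\<E> n\<close> governs the step from situations of
  length \<^term>\<open>n - 1\<close> to situations of length \<^term>\<open>n\<close>, and the value at index 0 is never used.\<close>

definition supermartingale ::
  "(nat \<Rightarrow> ('x \<Rightarrow> ereal) \<Rightarrow> ereal) \<Rightarrow> ('x list \<Rightarrow> ereal) \<Rightarrow> bool" where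
  "supermartingale \<E> S \<longleftrightarrow>
     (\<forall>n\<ge>1. \<forall>s. length s = n - 1 \<longrightarrow> \<E> n (\<lambda>x. S (s @ [x])) \<le> S s)"

definition bounded_below :: "('a \<Rightarrow> ereal) \<Rightarrow> bool" where
  "bounded_below f \<longleftrightarrow> (INF a. f a) > -\<infinity>"

definition upper_expectation ::
  "(nat \<Rightarrow> ('x \<Rightarrow> ereal) \<Rightarrow> ereal) \<Rightarrow> ('x stream \<Rightarrow> ereal) \<Rightarrow> 'x list \<Rightarrow> ereal" where
  "upper_expectation \<E> \<xi> s =
     Inf {S s | S. supermartingale \<E> S \<and> bounded_below S \<and>
                   (\<forall>\<omega>\<in>cylinder s. liminf (\<lambda>n. S (stake n \<omega>)) \<ge> \<xi> \<omega>)}"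

definition lower_expectation ::
  "(nat \<Rightarrow> ('x \<Rightarrow> ereal) \<Rightarrow> ereal) \<Rightarrow> ('x stream \<Rightarrow> ereal) \<Rightarrow> 'x list \<Rightarrow> ereal" where
  "lower_expectation \<E> \<xi> s = - upper_expectation \<E> (\<lambda>\<omega>. - \<xi> \<omega>) s"

definition lower_prob ::
  "(nat \<Rightarrow> ('x \<Rightarrow> ereal) \<Rightarrow> ereal) \<Rightarrow> 'x stream set \<Rightarrow> 'x list \<Rightarrow> ereal" where
  "lower_prob \<E> A s = lower_expectation \<E> (indicator A) s"

definition almost_all ::
  "(nat \<Rightarrow> ('x \<Rightarrow> ereal) \<Rightarrow> ereal) \<Rightarrow> ('x stream \<Rightarrow> bool) \<Rightarrow> bool" where
  "almost_all \<E> P \<longleftrightarrow> lower_prob \<E> {\<omega>. P \<omega>} [] = 1"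

end

theory Submission
  imports Defs "HOL-Library.Countable"
begin

text \<open>Shift \<open>\<xi>\<close> to be nonnegative, fix rationals \<open>0 < a < b\<close> and suppose that the upper expectation drops below \<open>a\<close> infinitely often
  while \<open>\<xi> > b\<close>. Whenever it is below \<open>a\<close>, some supermartingale costing less than \<open>a\<close> must later
  exceed \<open>b\<close>; playing it until then multiplies the capital by \<open>b / a\<close>, and \<open>k\<close> rounds multiply it by
  \<open>(b / a)^k\<close>. The contents are only finitely subadditive, so the strategies for the countably many
  pairs cannot simply be summed. However, each of them may be started arbitrarily late, and when
  the \<open>i\<close>-th one is idle up to time \<open>i\<close>, only finitely many are active at every step.\<close>

section \<open>Switching strategies at the first visit to a set of situations\<close>

text \<open>Only meaningful when some prefix of \<open>s\<close> lies in \<open>H\<close>: otherwise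
  \<open>LEAST\<close> is unspecified, which is why \<open>switch\<close> tests for such a prefix
  first.\<close>

definition first_hit :: "'x list set \<Rightarrow> 'x list \<Rightarrow> 'x list" where
  "first_hit H s = take (LEAST k. take k s \<in> H) s"

text \<open>The follow-up \<open>T u\<close> depends on the situation \<open>u\<close> of the first
  visit, since a separate supermartingale is chosen for each such situation. As
  \<open>take k s\<close> is \<open>s\<close> for large \<open>k\<close>, the test covers exactly
  the prefixes of \<open>s\<close>, including \<open>s\<close> itself.\<close>

definition switch ::
  "('x list \<Rightarrow> ereal) \<Rightarrow> 'x list set \<Rightarrow> ('x list \<Rightarrow> 'x list \<Rightarrow> ereal) \<Rightarrow> 'x list \<Rightarrow> ereal" where
  "switch S H T s = (if \<exists>k. take k s \<in> H then T (first_hit H s) s else S s)"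

lemma first_hit_in: "\<exists>k. take k s \<in> H \<Longrightarrow> first_hit H s \<in> H"
  unfolding first_hit_def by (rule LeastI_ex)

lemma first_hit_snoc:
  assumes "\<exists>k. take k s \<in> H"
  shows "first_hit H (s @ [x]) = first_hit H s"
proof -
  let ?k = "LEAST k. take k s \<in> H"
  have in_H: "take ?k s \<in> H"
    using assms by (rule LeastI_ex)
  have le: "?k \<le> length s"
    by (metis (no_types, lifting) Least_le assms in_H linorder_le_cases take_all_iff order_refl)
  have "(LEAST k. take k (s @ [x]) \<in> H) = ?k"
  proof (rule Least_equality)
    show "take ?k (s @ [x]) \<in> H"
      using in_H le by simp
    show "?k \<le> j" if "take j (s @ [x]) \<in> H" for j
    proof (cases "j \<le> length s")
      case True
      with that show ?thesis by (intro Least_le) simp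
    qed (use le in simp)
  qed
  then show ?thesis
    using le by (simp add: first_hit_def)
qed

lemma first_hit_now:
  assumes "s \<in> H" and "\<And>k. take k s \<in> H \<Longrightarrow> length s \<le> k"
  shows "first_hit H s = s"
proof -
  have "length s \<le> (LEAST k. take k s \<in> H)"
    by (rule assms(2), rule LeastI[of _ "length s"]) (use assms(1) in simp)
  then show ?thesis
    by (simp add: first_hit_def)
qed

lemma switch_snoc:
  assumes "\<exists>k. take k s \<in> H"
  shows "switch S H T (s @ [x]) = T (first_hit H s) (s @ [x])"
proof -
  obtain k where k: "take k s \<in> H"
    using assms by blast
  have "take (min k (length s)) (s @ [x]) \<in> H"
    using k by (cases "k \<le> length s") auto
  then have "\<exists>k. take k (s @ [x]) \<in> H"
    by blast
  then show ?thesis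
    unfolding switch_def first_hit_snoc[OF assms] by (rule if_P)
qed

lemma switch_snoc_new:
  assumes "\<nexists>k. take k s \<in> H"
  shows "switch S H T (s @ [x]) = (if s @ [x] \<in> H then T (s @ [x]) (s @ [x]) else S (s @ [x]))"
proof -
  have *: "Suc (length s) \<le> k" if "take k (s @ [x]) \<in> H" for k
  proof (rule ccontr)
    assume "\<not> Suc (length s) \<le> k"
    then have "take k s \<in> H" using that by simp
    then show False using assms by blast
  qed
  show ?thesis
  proof (cases "s @ [x] \<in> H")
    case True
    moreover from True have "first_hit H (s @ [x]) = s @ [x]"
      by (rule first_hit_now) (use * in simp)
    moreover from True have "take (Suc (length s)) (s @ [x]) \<in> H"
      by simp
    ultimately show ?thesis
      unfolding switch_def by metis
  next
    case False
    then have "\<nexists>k. take k (s @ [x]) \<in> H"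
      using * by (metis length_append_singleton take_all)
    with False show ?thesis
      by (auto simp: switch_def)
  qed
qed

text \<open>\<open>T u\<close> is only required to be nonnegative above \<open>u\<close>: a strategy
  bought at \<open>u\<close> is controlled only on continuations of \<open>u\<close>.\<close>

lemma switch_nonneg:
  assumes "\<And>s. 0 \<le> S s" and "\<And>u w. u \<in> H \<Longrightarrow> 0 \<le> T u (u @ w)"
  shows "0 \<le> switch S H T s"
proof (cases "\<exists>k. take k s \<in> H")
  case True
  have "s = first_hit H s @ drop (LEAST k. take k s \<in> H) s"
    by (simp add: first_hit_def)
  then have "0 \<le> T (first_hit H s) s"
    using assms(2)[OF first_hit_in[OF True]] by metis
  with True show ?thesis
    by (simp add: switch_def)
qed (simp add: switch_def assms)

text \<open>A prefix of \<open>s\<close> in \<open>H\<close> must have length at least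
  \<open>N\<close>, hence be all of \<open>s\<close>. Initial capitals are read off from
  this.\<close>

lemma switch_short:
  assumes "\<And>u. u \<in> H \<Longrightarrow> N \<le> length u" and "length s \<le> N"
  shows "switch S H T s = (if s \<in> H then T s s else S s)"
proof -
  have *: "length s \<le> k" if "take k s \<in> H" for k
    using assms(1)[OF that] assms(2) by simp
  show ?thesis
  proof (cases "s \<in> H")
    case True
    from True * have "first_hit H s = s" by (rule first_hit_now)
    moreover from True have "take (length s) s \<in> H" by simp
    ultimately show ?thesis
      using True unfolding switch_def by metis
  next
    case False
    then have "\<nexists>k. take k s \<in> H"
      using * by (metis take_all)
    with False show ?thesis
      by (auto simp: switch_def)
  qed
qed

text \<open>Along a path that meets \<open>H\<close>, one fixed follow-up is played from the first
  visiting time \<open>m\<close> on, so the eventual behaviour is that of this follow-up.\<close>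

lemma switch_stake:
  assumes "stake n \<omega> \<in> H"
  obtains m where "stake m \<omega> \<in> H"
    and "\<And>j. m \<le> j \<Longrightarrow> switch S H T (stake j \<omega>) = T (stake m \<omega>) (stake j \<omega>)"
proof -
  define m where "m = (LEAST m. stake m \<omega> \<in> H)"
  have in_H: "stake m \<omega> \<in> H"
    unfolding m_def using assms by (rule LeastI)
  have "(\<exists>k. take k (stake j \<omega>) \<in> H) \<and> first_hit H (stake j \<omega>) = stake m \<omega>" if "m \<le> j" for j
    using that
  proof (induction j rule: dec_induct)
    case base
    have "first_hit H (stake m \<omega>) = stake m \<omega>"
    proof (rule first_hit_now[OF in_H])
      fix k
      assume "take k (stake m \<omega>) \<in> H"
      then have "stake (min k m) \<omega> \<in> H"
        by (simp add: take_stake min.commute)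
      then have "m \<le> min k m"
        unfolding m_def by (rule Least_le)
      then show "length (stake m \<omega>) \<le> k"
        by simp
    qed
    moreover have "take m (stake m \<omega>) \<in> H"
      using in_H by simp
    ultimately show ?case by blast
  next
    case (step j)
    then have ex: "\<exists>k. take k (stake j \<omega>) \<in> H" by blast
    have "first_hit H (stake (Suc j) \<omega>) = stake m \<omega>"
      using first_hit_snoc[OF ex] step.IH by (simp only: stake_Suc)
    moreover have "take m (stake (Suc j) \<omega>) \<in> H"
      using in_H step.hyps by (simp only: take_stake) (simp add: min_absorb1)
    ultimately show ?case by blast
  qed
  then show thesis
    using that in_H by (auto simp: switch_def)
qed

section \<open>Supermartingales under outer probability contents\<close>

locale outer_contents =
  fixes \<E> :: "nat \<Rightarrow> ('x \<Rightarrow> ereal) \<Rightarrow> ereal"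
  assumes content: "n \<ge> 1 \<Longrightarrow> outer_prob_content (\<E> n)"
begin

lemma content_mono: "(\<And>x. f x \<le> g x) \<Longrightarrow> \<E> (Suc n) f \<le> \<E> (Suc n) g"
  and content_scale: "0 < c \<Longrightarrow> \<E> (Suc n) (\<lambda>x. ereal c * f x) = ereal c * \<E> (Suc n) f"
  and content_add: "\<E> (Suc n) (\<lambda>x. f x + g x) \<le> \<E> (Suc n) f + \<E> (Suc n) g"
  and content_const: "\<E> (Suc n) (\<lambda>x. ereal c) = ereal c"
  using content[of "Suc n"] unfolding outer_prob_content_def by auto

lemma content_sum: "\<E> (Suc n) (\<lambda>x. \<Sum>i<k. f i x) \<le> (\<Sum>i<k. \<E> (Suc n) (f i))" for k :: nat
proof (induction k)
  case 0
  show ?case using content_const[of n 0] by (simp add: zero_ereal_def)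
next
  case (Suc k)
  have "\<E> (Suc n) (\<lambda>x. \<Sum>i<Suc k. f i x) \<le> \<E> (Suc n) (\<lambda>x. \<Sum>i<k. f i x) + \<E> (Suc n) (f k)"
    by (simp add: content_add)
  also have "\<dots> \<le> (\<Sum>i<k. \<E> (Suc n) (f i)) + \<E> (Suc n) (f k)"
    by (intro add_right_mono Suc.IH)
  finally show ?case by simp
qed

lemma supermartingale_iff:
  "supermartingale \<E> S \<longleftrightarrow> (\<forall>s. \<E> (Suc (length s)) (\<lambda>x. S (s @ [x])) \<le> S s)"
proof
  assume "supermartingale \<E> S"
  then show "\<forall>s. \<E> (Suc (length s)) (\<lambda>x. S (s @ [x])) \<le> S s"
    by (simp add: supermartingale_def)
next
  assume "\<forall>s. \<E> (Suc (length s)) (\<lambda>x. S (s @ [x])) \<le> S s"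
  then show "supermartingale \<E> S"
    unfolding supermartingale_def by (metis Suc_diff_1 less_eq_Suc_le One_nat_def)
qed

lemma supermartingaleD: "supermartingale \<E> S \<Longrightarrow> \<E> (Suc (length s)) (\<lambda>x. S (s @ [x])) \<le> S s"
  by (simp add: supermartingale_iff)

lemma supermartingale_const: "supermartingale \<E> (\<lambda>s. ereal c)"
  by (simp add: supermartingale_iff content_const)

lemma supermartingale_scale:
  assumes "supermartingale \<E> S" and "0 < c"
  shows "supermartingale \<E> (\<lambda>s. ereal c * S s)"
  unfolding supermartingale_iff using supermartingaleD[OF assms(1)] assms(2)
  by (auto simp: content_scale intro!: ereal_mult_left_mono)

lemma supermartingale_add_const:
  assumes "supermartingale \<E> S"
  shows "supermartingale \<E> (\<lambda>s. S s + ereal c)"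
  unfolding supermartingale_iff
proof
  fix s
  have "\<E> (Suc (length s)) (\<lambda>x. S (s @ [x]) + ereal c)
      \<le> \<E> (Suc (length s)) (\<lambda>x. S (s @ [x])) + ereal c"
    using content_add[of "length s" "\<lambda>x. S (s @ [x])" "\<lambda>x. ereal c"] by (simp add: content_const)
  also have "\<dots> \<le> S s + ereal c"
    by (intro add_right_mono supermartingaleD assms)
  finally show "\<E> (Suc (length s)) (\<lambda>x. S (s @ [x]) + ereal c) \<le> S s + ereal c" .
qed

text \<open>Before the first visit, switching at a successor can only lower its value, because
  \<open>T u u \<le> S u\<close>, so monotonicity of the content suffices. Afterwards a single
  \<open>T u\<close> is followed.\<close>

lemma supermartingale_switch:
  assumes "supermartingale \<E> S" and "\<And>u. u \<in> H \<Longrightarrow> supermartingale \<E> (T u)"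
    and "\<And>u. u \<in> H \<Longrightarrow> T u u \<le> S u"
  shows "supermartingale \<E> (switch S H T)"
  unfolding supermartingale_iff
proof
  fix s
  show "\<E> (Suc (length s)) (\<lambda>x. switch S H T (s @ [x])) \<le> switch S H T s"
  proof (cases "\<exists>k. take k s \<in> H")
    case True
    then show ?thesis
      using supermartingaleD[OF assms(2)[OF first_hit_in[OF True]]]
      unfolding switch_snoc[OF True] by (simp add: switch_def)
  next
    case False
    have "\<E> (Suc (length s)) (\<lambda>x. switch S H T (s @ [x])) \<le> \<E> (Suc (length s)) (\<lambda>x. S (s @ [x]))"
      unfolding switch_snoc_new[OF False] by (intro content_mono) (simp add: assms(3))
    also have "\<dots> \<le> S s"
      by (rule supermartingaleD[OF assms(1)])
    also have "\<dots> = switch S H T s"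
      using False by (simp add: switch_def)
    finally show ?thesis .
  qed
qed

text \<open>If all successors of \<open>s\<close> had value at least \<open>c\<close>, monotonicity
  and \<open>content_const\<close> would force \<open>S s\<close> to be at least \<open>c\<close>.
  So a value below \<open>c\<close> always has a successor below \<open>c\<close>, and iterating
  this choice gives the path.\<close>

lemma supermartingale_path_below:
  assumes S: "supermartingale \<E> S" and "S v < ereal c"
  obtains \<omega> where "\<omega> \<in> cylinder v" and "\<And>n. length v \<le> n \<Longrightarrow> S (stake n \<omega>) < ereal c"
proof -
  have "\<exists>x. S (s @ [x]) < ereal c" if "S s < ereal c" for s
  proof (rule ccontr)
    assume "\<nexists>x. S (s @ [x]) < ereal c"
    then have "\<E> (Suc (length s)) (\<lambda>x. ereal c) \<le> \<E> (Suc (length s)) (\<lambda>x. S (s @ [x]))"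
      by (intro content_mono) (simp add: not_less)
    with supermartingaleD[OF S, of s] that show False
      by (simp add: content_const)
  qed
  then obtain g where g: "\<And>s. S s < ereal c \<Longrightarrow> S (s @ [g s]) < ereal c"
    by metis
  define f where "f s = s @ [g s]" for s
  define t where "t k = (f ^^ k) v" for k
  define \<omega> where "\<omega> = v @- smap (\<lambda>k. g (t k)) nats"
  have below: "S (t k) < ereal c" for k
    by (induction k) (simp_all add: t_def f_def g assms(2))
  have "v @ stake k (smap (\<lambda>k. g (t k)) nats) = t k" for k
  proof (induction k)
    case 0
    show ?case by (simp add: t_def)
  next
    case (Suc k)
    then show ?case
      by (simp only: stake_Suc append_assoc[symmetric]) (simp add: t_def f_def)
  qed
  then have stake_\<omega>: "stake (length v + k) \<omega> = t k" for k
    by (simp add: \<omega>_def stake_shift)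
  show thesis
  proof
    show "\<omega> \<in> cylinder v"
      by (simp add: cylinder_def \<omega>_def stake_shift)
    show "S (stake n \<omega>) < ereal c" if "length v \<le> n" for n
      using stake_\<omega>[of "n - length v"] below that by simp
  qed
qed

lemma supermartingale_ge:
  assumes S: "supermartingale \<E> S"
    and "\<And>\<omega>. \<omega> \<in> cylinder v \<Longrightarrow> ereal c \<le> liminf (\<lambda>n. S (stake n \<omega>))"
  shows "ereal c \<le> S v"
proof (rule ccontr)
  assume "\<not> ereal c \<le> S v"
  \<comment> \<open>An intermediate level is needed because values below \<open>c\<close> may still
    have limit inferior \<open>c\<close>.\<close>
  then obtain d where d: "S v < ereal d" "ereal d < ereal c"
    using ereal_dense2[of "S v" "ereal c"] by (meson not_le)
  obtain \<omega> where \<omega>: "\<omega> \<in> cylinder v" and below: "\<And>n. length v \<le> n \<Longrightarrow> S (stake n \<omega>) < ereal d"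
    using supermartingale_path_below[OF S d(1)] by blast
  have "liminf (\<lambda>n. S (stake n \<omega>)) \<le> liminf (\<lambda>n. ereal d)"
    by (intro Liminf_mono eventually_sequentiallyI[of "length v"]) (simp add: below less_imp_le)
  then have "liminf (\<lambda>n. S (stake n \<omega>)) \<le> ereal d"
    by (simp add: Liminf_const)
  also note d(2)
  finally show False
    using assms(2)[OF \<omega>] by (simp add: not_le[symmetric])
qed

text \<open>By \<open>supermartingale_ge\<close> every competitor in the infimum is at least
  \<open>c\<close> at \<open>v\<close>.\<close>

lemma upper_expectation_ge:
  assumes "\<And>\<omega>. \<omega> \<in> cylinder v \<Longrightarrow> ereal c \<le> \<xi> \<omega>"
  shows "ereal c \<le> upper_expectation \<E> \<xi> v"
  unfolding upper_expectation_def
proof (rule Inf_greatest, clarsimp)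
  fix S
  assume "supermartingale \<E> S" and "\<forall>\<omega>\<in>cylinder v. \<xi> \<omega> \<le> liminf (\<lambda>n. S (stake n \<omega>))"
  then show "ereal c \<le> S v"
    using assms order_trans by (blast intro: supermartingale_ge)
qed

section \<open>Upcrossing strategies and late null sets\<close>

text \<open>The induction puts a new round in front of \<open>k\<close> rounds: hold cash until
  \<open>H\<close> is visited at time \<open>N\<close> or later, invest in \<open>W\<close> there
  until it reaches \<open>b\<close>, then use the proceeds for the remaining rounds. Each round
  lowers the required initial capital by the factor \<open>a / b\<close>.\<close>

lemma upcrossing_supermartingale:
  fixes W :: "'x list \<Rightarrow> 'x list \<Rightarrow> ereal"
  assumes "0 < a" "a < b"
    and W: "\<And>t. t \<in> H \<Longrightarrow> supermartingale \<E> (W t)"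
    and W_start: "\<And>t. t \<in> H \<Longrightarrow> W t t \<le> ereal a"
    and W_nonneg: "\<And>t w. t \<in> H \<Longrightarrow> 0 \<le> W t (t @ w)"
    and down: "\<And>\<omega> N. \<omega> \<in> G \<Longrightarrow> \<exists>n\<ge>N. stake n \<omega> \<in> H"
    and up: "\<And>\<omega> n. \<omega> \<in> G \<Longrightarrow> stake n \<omega> \<in> H \<Longrightarrow> \<exists>m\<ge>n. ereal b \<le> W (stake n \<omega>) (stake m \<omega>)"
  shows "\<exists>R. supermartingale \<E> R \<and> (\<forall>s. 0 \<le> R s) \<and> (\<forall>s. length s \<le> N \<longrightarrow> R s \<le> ereal ((a / b) ^ k))
    \<and> (\<forall>\<omega>\<in>G. \<forall>\<^sub>F n in sequentially. 1 \<le> R (stake n \<omega>))"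
proof (induction k arbitrary: N)
  case 0
  show ?case
    by (rule exI[of _ "\<lambda>s. ereal 1"]) (use supermartingale_const in simp)
next
  case (Suc k)
  define q where "q = (a / b) ^ k"
  have q: "0 < q"
    using assms(1,2) by (simp add: q_def)
  \<comment> \<open>The time at which the first round ends depends on the path, so a strategy for
    the remaining rounds is kept ready for every starting time.\<close>
  have "\<forall>N. \<exists>R. supermartingale \<E> R \<and> (\<forall>s. 0 \<le> R s) \<and> (\<forall>s. length s \<le> N \<longrightarrow> R s \<le> ereal q)
      \<and> (\<forall>\<omega>\<in>G. \<forall>\<^sub>F n in sequentially. 1 \<le> R (stake n \<omega>))"
    unfolding q_def using Suc.IH by blast
  then obtain R where R: "\<And>N. supermartingale \<E> (R N)" and R_nonneg: "\<And>N s. 0 \<le> R N s"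
    and R_start: "\<And>N s. length s \<le> N \<Longrightarrow> R N s \<le> ereal q"
    and R_end: "\<And>N \<omega>. \<omega> \<in> G \<Longrightarrow> \<forall>\<^sub>F n in sequentially. 1 \<le> R N (stake n \<omega>)"
    by metis
  define K where "K t = {u. length t \<le> length u \<and> ereal b \<le> W t u}" for t
  \<comment> \<open>On entering \<open>K t\<close>, the \<open>q / b\<close> copies of
    \<open>W t\<close> are worth at least \<open>q\<close>, which pays for
    \<open>R (length u)\<close>.\<close>
  define V where "V t = switch (\<lambda>v. ereal (q / b) * W t v) (K t) (\<lambda>u. R (length u))" for t
  define H' where "H' = {t \<in> H. N \<le> length t}"
  \<comment> \<open>The cash \<open>q * a / b\<close> buys \<open>q / b\<close> copies of a strategy
    priced at most \<open>a\<close>.\<close>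
  define Z where "Z = switch (\<lambda>s. ereal (q * a / b)) H' V"
  have V: "supermartingale \<E> (V t)" if "t \<in> H" for t
    unfolding V_def
  proof (rule supermartingale_switch)
    show "supermartingale \<E> (\<lambda>v. ereal (q / b) * W t v)"
      using q assms(1,2) by (intro supermartingale_scale W that) simp
    show "R (length u) u \<le> ereal (q / b) * W t u" if "u \<in> K t" for u
    proof -
      have "R (length u) u \<le> ereal (q / b) * ereal b"
        using R_start[of u "length u"] assms(1,2) by simp
      also have "\<dots> \<le> ereal (q / b) * W t u"
        using that q assms(1,2) by (intro ereal_mult_left_mono) (auto simp: K_def)
      finally show ?thesis .
    qed
  qed (rule R)
  have V_start: "V t t \<le> ereal (q * a / b)" if "t \<in> H" for t
  proof -
    \<comment> \<open>No switch happens at \<open>t\<close> itself, so the price of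
      \<open>V t\<close> is that of the copies of \<open>W t\<close>.\<close>
    have "W t t < ereal b"
      using W_start[OF that] by (rule le_less_trans) (simp add: assms(2))
    then have "t \<notin> K t"
      by (simp add: K_def not_le)
    then have "V t t = ereal (q / b) * W t t"
      unfolding V_def by (subst switch_short[of _ "length t"]) (auto simp: K_def)
    also have "\<dots> \<le> ereal (q / b) * ereal a"
      using W_start[OF that] q assms(1,2) by (intro ereal_mult_left_mono) auto
    finally show ?thesis by simp
  qed
  have V_nonneg: "0 \<le> V t (t @ w)" if "t \<in> H" for t w
    unfolding V_def switch_def using W_nonneg[OF that, of w] R_nonneg q assms(1,2) by simp
  have "supermartingale \<E> Z"
    unfolding Z_def by (rule supermartingale_switch) (auto simp: supermartingale_const H'_def V V_start)
  moreover have "0 \<le> Z s" for s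
    unfolding Z_def by (rule switch_nonneg) (use q assms(1,2) V_nonneg in \<open>auto simp: H'_def\<close>)
  moreover have "Z s \<le> ereal ((a / b) ^ Suc k)" if "length s \<le> N" for s
  proof -
    have "Z s \<le> ereal (q * a / b)"
      unfolding Z_def by (subst switch_short[OF _ that]) (auto simp: H'_def V_start)
    then show ?thesis
      by (simp add: q_def mult.commute)
  qed
  moreover have "\<forall>\<^sub>F n in sequentially. 1 \<le> Z (stake n \<omega>)" if \<omega>: "\<omega> \<in> G" for \<omega>
  proof -
    obtain n where "stake n \<omega> \<in> H'"
      using down[OF \<omega>, of N] by (auto simp: H'_def)
    then obtain m where m: "stake m \<omega> \<in> H'"
      and Z: "\<And>j. m \<le> j \<Longrightarrow> Z (stake j \<omega>) = V (stake m \<omega>) (stake j \<omega>)"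
      unfolding Z_def by (rule switch_stake[where S="\<lambda>s. ereal (q * a / b)" and T=V]) blast
    obtain i where "m \<le> i" "ereal b \<le> W (stake m \<omega>) (stake i \<omega>)"
      using up[OF \<omega>] m unfolding H'_def by blast
    then have "stake i \<omega> \<in> K (stake m \<omega>)"
      by (simp add: K_def)
    then obtain l where V: "\<And>j. l \<le> j \<Longrightarrow> V (stake m \<omega>) (stake j \<omega>) = R l (stake j \<omega>)"
      unfolding V_def
      by (rule switch_stake[where S="\<lambda>v. ereal (q / b) * W (stake m \<omega>) v" and T="\<lambda>u. R (length u)"])
        auto
    show ?thesis
      using R_end[OF \<omega>, of l] eventually_ge_at_top[of "max m l"]
      by eventually_elim (simp add: Z V)
  qed
  ultimately show ?case by blast
qed

text \<open>A uniform bound up to an arbitrary time \<open>N\<close> is what makes this smallness stable under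
  countable unions.\<close>

definition late_null :: "'x stream set \<Rightarrow> bool" where
  "late_null G \<longleftrightarrow> (\<forall>N. \<forall>\<epsilon>>0. \<exists>R. supermartingale \<E> R \<and> (\<forall>s. 0 \<le> R s) \<and>
     (\<forall>s. length s \<le> N \<longrightarrow> R s \<le> ereal \<epsilon>) \<and> (\<forall>\<omega>\<in>G. \<forall>\<^sub>F n in sequentially. 1 \<le> R (stake n \<omega>)))"

lemma late_null_empty: "late_null {}"
  unfolding late_null_def using supermartingale_const[of 0]
  by (auto intro!: exI[of _ "\<lambda>s. 0"] simp: zero_ereal_def)

text \<open>The strategy for \<open>G i\<close> is chosen with \<open>N = i\<close> and allotment
  \<open>\<epsilon> / 2 ^ Suc i\<close>. It stays within its allotment until it joins the sum, so
  each step involves a finite sum, to which \<open>content_sum\<close> applies.\<close>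

lemma late_null_UN_cover:
  fixes G :: "nat \<Rightarrow> 'x stream set"
  assumes null: "\<And>i. late_null (G i)" and "0 < \<epsilon>"
  obtains T where "supermartingale \<E> T" and "\<And>s. 0 \<le> T s" and "T [] = ereal \<epsilon>"
    and "\<And>\<omega>. \<omega> \<in> (\<Union>i. G i) \<Longrightarrow> \<forall>\<^sub>F n in sequentially. 1 \<le> T (stake n \<omega>)"
proof -
  have "\<exists>R. supermartingale \<E> R \<and> (\<forall>s. 0 \<le> R s) \<and>
     (\<forall>s. length s \<le> i \<longrightarrow> R s \<le> ereal (\<epsilon> / 2 ^ Suc i)) \<and>
     (\<forall>\<omega>\<in>G i. \<forall>\<^sub>F n in sequentially. 1 \<le> R (stake n \<omega>))" for i
    by (rule null[unfolded late_null_def, rule_format]) (use \<open>0 < \<epsilon>\<close> in simp)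
  then obtain R where R: "\<And>i. supermartingale \<E> (R i)" and R_nonneg: "\<And>i s. 0 \<le> R i s"
    and R_start: "\<And>i s. length s \<le> i \<Longrightarrow> R i s \<le> ereal (\<epsilon> / 2 ^ Suc i)"
    and R_end: "\<And>i \<omega>. \<omega> \<in> G i \<Longrightarrow> \<forall>\<^sub>F n in sequentially. 1 \<le> R i (stake n \<omega>)"
    by metis
  \<comment> \<open>The last summand is the total initial capital of the strategies not yet started.\<close>
  define T where "T s = (\<Sum>i<length s. R i s) + ereal (\<epsilon> / 2 ^ length s)" for s
  show thesis
  proof
    show "supermartingale \<E> T"
      unfolding supermartingale_iff
    proof
      fix s :: "'x list"
      let ?l = "length s"
      have "\<E> (Suc ?l) (\<lambda>x. T (s @ [x]))
          \<le> \<E> (Suc ?l) (\<lambda>x. \<Sum>i<Suc ?l. R i (s @ [x])) + ereal (\<epsilon> / 2 ^ Suc ?l)"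
        using content_add[of ?l "\<lambda>x. \<Sum>i<Suc ?l. R i (s @ [x])" "\<lambda>x. ereal (\<epsilon> / 2 ^ Suc ?l)"]
        unfolding T_def content_const length_append_singleton .
      also have "\<dots> \<le> (\<Sum>i<Suc ?l. \<E> (Suc ?l) (\<lambda>x. R i (s @ [x]))) + ereal (\<epsilon> / 2 ^ Suc ?l)"
        by (intro add_right_mono content_sum)
      also have "\<dots> \<le> (\<Sum>i<Suc ?l. R i s) + ereal (\<epsilon> / 2 ^ Suc ?l)"
        by (intro add_right_mono sum_mono supermartingaleD R)
      also have "\<dots> = (\<Sum>i<?l. R i s) + (R ?l s + ereal (\<epsilon> / 2 ^ Suc ?l))"
        by (simp add: add.assoc)
      \<comment> \<open>Strategy number \<open>?l\<close> joins at this step: half of the reserve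
        pays for it, and the other half is the new reserve.\<close>
      also have "\<dots> \<le> (\<Sum>i<?l. R i s) + (ereal (\<epsilon> / 2 ^ Suc ?l) + ereal (\<epsilon> / 2 ^ Suc ?l))"
        by (intro add_left_mono add_right_mono R_start) simp
      also have "\<dots> = T s"
        by (simp add: T_def)
      finally show "\<E> (Suc ?l) (\<lambda>x. T (s @ [x])) \<le> T s" .
    qed
    show "0 \<le> T s" for s
      using \<open>0 < \<epsilon>\<close> by (simp add: T_def sum_nonneg R_nonneg)
    show "T [] = ereal \<epsilon>"
      by (simp add: T_def)
    show "\<forall>\<^sub>F n in sequentially. 1 \<le> T (stake n \<omega>)" if \<omega>: "\<omega> \<in> (\<Union>i. G i)" for \<omega>
    proof -
      obtain i where i: "\<omega> \<in> G i"
        using \<omega> by blast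
      show ?thesis
        using R_end[OF i] eventually_gt_at_top[of i]
      proof eventually_elim
        case (elim n)
        have "1 \<le> R i (stake n \<omega>)"
          by (rule elim(1))
        also have "\<dots> \<le> (\<Sum>j<n. R j (stake n \<omega>))"
          using sum_mono2[of "{..<n}" "{i}" "\<lambda>j. R j (stake n \<omega>)"] elim(2) R_nonneg by simp
        also have "\<dots> \<le> T (stake n \<omega>)"
          using \<open>0 < \<epsilon>\<close> by (simp add: T_def ereal_le_add_self)
        finally show ?case .
      qed
    qed
  qed
qed

text \<open>Where the upper expectation is below \<open>a\<close>, the infimum supplies a covering
  supermartingale \<open>S\<close> with value below \<open>a\<close>; on a path with
  \<open>\<xi>\<close> above \<open>b\<close> it eventually exceeds \<open>b\<close>. Subtracting
  \<open>c\<close> makes it nonnegative and turns the levels into \<open>0 < a - c < b - c\<close>,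
  as the upcrossing construction requires.\<close>

lemma late_null_gap:
  assumes bound: "\<And>\<omega>. ereal c \<le> \<xi> \<omega>" and "c < a" "a < b"
  shows "late_null {\<omega>. liminf (\<lambda>n. upper_expectation \<E> \<xi> (stake n \<omega>)) < ereal a \<and> ereal b < \<xi> \<omega>}"
    (is "late_null ?G")
proof -
  define H where "H = {t. upper_expectation \<E> \<xi> t < ereal a}"
  have "\<exists>W. supermartingale \<E> W \<and> W t \<le> ereal (a - c) \<and> (\<forall>w. 0 \<le> W (t @ w)) \<and>
      (\<forall>\<omega>\<in>cylinder t. ereal b < \<xi> \<omega> \<longrightarrow> (\<forall>\<^sub>F n in sequentially. ereal (b - c) \<le> W (stake n \<omega>)))"
    if "t \<in> H" for t
  proof -
    obtain S where S: "supermartingale \<E> S" and St: "S t < ereal a"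
      and cover: "\<And>\<omega>. \<omega> \<in> cylinder t \<Longrightarrow> \<xi> \<omega> \<le> liminf (\<lambda>n. S (stake n \<omega>))"
      using \<open>t \<in> H\<close> unfolding H_def upper_expectation_def by (auto simp: Inf_less_iff)
    have shift: "ereal (x - c) \<le> y + ereal (- c)" if "ereal x \<le> y" for x y
      using that by (cases y) auto
    \<comment> \<open>\<open>S\<close> covers \<open>\<xi>\<close> only on
      \<open>cylinder t\<close>, so its lower bound \<open>c\<close> is available only at extensions
      of \<open>t\<close>.\<close>
    have "ereal c \<le> S (t @ w)" for w
    proof (rule supermartingale_ge[OF S])
      fix \<omega>
      assume "\<omega> \<in> cylinder (t @ w)"
      then have "take (length t) (stake (length (t @ w)) \<omega>) = t"
        by (simp add: cylinder_def)
      then have "\<omega> \<in> cylinder t"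
        by (simp add: cylinder_def take_stake min_absorb1)
      then show "ereal c \<le> liminf (\<lambda>n. S (stake n \<omega>))"
        using bound cover order_trans by blast
    qed
    then have "0 \<le> S (t @ w) + ereal (- c)" for w
      using shift[of c] by (simp add: zero_ereal_def)
    moreover have "S t + ereal (- c) \<le> ereal (a - c)"
      using St by (cases "S t") auto
    moreover have "\<forall>\<^sub>F n in sequentially. ereal (b - c) \<le> S (stake n \<omega>) + ereal (- c)"
      if "\<omega> \<in> cylinder t" "ereal b < \<xi> \<omega>" for \<omega>
    proof -
      have "ereal b < liminf (\<lambda>n. S (stake n \<omega>))"
        using that cover less_le_trans by blast
      then have "\<forall>\<^sub>F n in sequentially. ereal b < S (stake n \<omega>)"
        by (rule less_LiminfD)
      then show ?thesis
        by eventually_elim (simp add: shift less_imp_le)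
    qed
    ultimately show ?thesis
      using supermartingale_add_const[OF S] by blast
  qed
  then obtain W where W: "\<And>t. t \<in> H \<Longrightarrow> supermartingale \<E> (W t)"
    and W_start: "\<And>t. t \<in> H \<Longrightarrow> W t t \<le> ereal (a - c)"
    and W_nonneg: "\<And>t w. t \<in> H \<Longrightarrow> 0 \<le> W t (t @ w)"
    and W_end: "\<And>t \<omega>. t \<in> H \<Longrightarrow> \<omega> \<in> cylinder t \<Longrightarrow> ereal b < \<xi> \<omega> \<Longrightarrow>
      \<forall>\<^sub>F n in sequentially. ereal (b - c) \<le> W t (stake n \<omega>)"
    by metis
  have down: "\<exists>n\<ge>N. stake n \<omega> \<in> H" if "\<omega> \<in> ?G" for \<omega> N
  proof (rule ccontr)
    assume "\<nexists>n. N \<le> n \<and> stake n \<omega> \<in> H"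
    then have "\<forall>\<^sub>F n in sequentially. ereal a \<le> upper_expectation \<E> \<xi> (stake n \<omega>)"
      by (intro eventually_sequentiallyI[of N]) (auto simp: H_def not_less)
    then have "ereal a \<le> liminf (\<lambda>n. upper_expectation \<E> \<xi> (stake n \<omega>))"
      by (rule Liminf_bounded)
    with that show False by auto
  qed
  have up: "\<exists>m\<ge>n. ereal (b - c) \<le> W (stake n \<omega>) (stake m \<omega>)"
    if "\<omega> \<in> ?G" "stake n \<omega> \<in> H" for \<omega> n
  proof -
    have "\<forall>\<^sub>F m in sequentially. ereal (b - c) \<le> W (stake n \<omega>) (stake m \<omega>)"
      using that by (intro W_end) (auto simp: cylinder_def)
    then obtain M where "\<And>m. M \<le> m \<Longrightarrow> ereal (b - c) \<le> W (stake n \<omega>) (stake m \<omega>)"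
      unfolding eventually_sequentially by blast
    then show ?thesis
      by (intro exI[of _ "max M n"]) simp
  qed
  show ?thesis
    unfolding late_null_def
  proof (intro allI impI)
    fix N :: nat and \<epsilon> :: real
    assume "0 < \<epsilon>"
    then obtain k where k: "((a - c) / (b - c)) ^ k < \<epsilon>"
      using real_arch_pow_inv[of \<epsilon> "(a - c) / (b - c)"] assms(2,3) by auto
    have "\<exists>R. supermartingale \<E> R \<and> (\<forall>s. 0 \<le> R s) \<and>
        (\<forall>s. length s \<le> N \<longrightarrow> R s \<le> ereal (((a - c) / (b - c)) ^ k)) \<and>
        (\<forall>\<omega>\<in>?G. \<forall>\<^sub>F n in sequentially. 1 \<le> R (stake n \<omega>))"
      by (rule upcrossing_supermartingale[OF _ _ W W_start W_nonneg down up])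
        (use assms(2,3) in simp_all)
    then obtain R where R: "supermartingale \<E> R" "\<forall>s. 0 \<le> R s"
      "\<forall>s. length s \<le> N \<longrightarrow> R s \<le> ereal (((a - c) / (b - c)) ^ k)"
      "\<forall>\<omega>\<in>?G. \<forall>\<^sub>F n in sequentially. 1 \<le> R (stake n \<omega>)"
      by blast
    have "\<forall>s. length s \<le> N \<longrightarrow> R s \<le> ereal \<epsilon>"
      using R(3) k by (meson ereal_less_eq(3) less_imp_le order_trans)
    with R show "\<exists>R. supermartingale \<E> R \<and> (\<forall>s. 0 \<le> R s) \<and>
        (\<forall>s. length s \<le> N \<longrightarrow> R s \<le> ereal \<epsilon>) \<and>
        (\<forall>\<omega>\<in>?G. \<forall>\<^sub>F n in sequentially. 1 \<le> R (stake n \<omega>))"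
      by blast
  qed
qed

section \<open>From late null sets to almost sure statements\<close>

text \<open>Lower probability one means that the negated indicator has upper expectation
  \<open>- 1\<close>. The bound from below is \<open>upper_expectation_ge\<close>; for the other, a
  nonnegative \<open>T\<close> of initial value \<open>\<epsilon>\<close> that eventually reaches 1
  on the exceptional set gives the competitor \<open>T - 1\<close>.\<close>

lemma almost_all_if_late_null_UN:
  fixes G :: "nat \<Rightarrow> 'x stream set"
  assumes null: "\<And>i. late_null (G i)" and exception: "\<And>\<omega>. \<not> P \<omega> \<Longrightarrow> \<omega> \<in> (\<Union>i. G i)"
  shows "almost_all \<E> P"
proof -
  let ?f = "\<lambda>\<omega>. - (indicator {\<omega>. P \<omega>} \<omega> :: ereal)"
  have "ereal (- 1) \<le> upper_expectation \<E> ?f []"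
    by (rule upper_expectation_ge) (simp add: indicator_def zero_ereal_def one_ereal_def)
  moreover have "upper_expectation \<E> ?f [] \<le> ereal (- 1)"
  proof (rule ereal_le_epsilon2)
    fix \<epsilon> :: real
    assume "0 < \<epsilon>"
    then obtain T where T: "supermartingale \<E> T" and T_nonneg: "\<And>s. 0 \<le> T s"
      and T_start: "T [] = ereal \<epsilon>"
      and T_end: "\<And>\<omega>. \<omega> \<in> (\<Union>i. G i) \<Longrightarrow> \<forall>\<^sub>F n in sequentially. 1 \<le> T (stake n \<omega>)"
      by (rule late_null_UN_cover[of G, OF null]) blast
    define S where "S s = T s + ereal (- 1)" for s
    have shift: "ereal (x - 1) \<le> S s" if "ereal x \<le> T s" for x s
      unfolding S_def using that by (cases "T s") auto
    have S_ge: "ereal (- 1) \<le> S s" for s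
      using shift[of 0 s] T_nonneg by (simp add: zero_ereal_def)
    have "bounded_below S"
      unfolding bounded_below_def
      by (rule less_le_trans[of _ "ereal (- 1)"]) (simp_all add: le_INF_iff S_ge)
    moreover have "supermartingale \<E> S"
      unfolding S_def by (rule supermartingale_add_const[OF T])
    moreover have "?f \<omega> \<le> liminf (\<lambda>n. S (stake n \<omega>))" for \<omega>
    proof (cases "P \<omega>")
      case True
      then show ?thesis
        using Liminf_bounded[of "ereal (- 1)" "\<lambda>n. S (stake n \<omega>)" sequentially]
        by (simp add: S_ge one_ereal_def)
    next
      case False
      from T_end[OF exception[OF False]]
      have "\<forall>\<^sub>F n in sequentially. 0 \<le> S (stake n \<omega>)"
        by eventually_elim (use shift[of 1] in \<open>simp add: zero_ereal_def one_ereal_def\<close>)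
      then have "0 \<le> liminf (\<lambda>n. S (stake n \<omega>))"
        by (rule Liminf_bounded)
      with False show ?thesis by simp
    qed
    ultimately have "upper_expectation \<E> ?f [] \<le> S []"
      unfolding upper_expectation_def by (intro Inf_lower) blast
    then show "upper_expectation \<E> ?f [] \<le> ereal (- 1) + ereal \<epsilon>"
      by (simp add: S_def T_start)
  qed
  ultimately have "upper_expectation \<E> ?f [] = ereal (- 1)"
    by (rule antisym[rotated])
  then show ?thesis
    by (simp add: almost_all_def lower_prob_def lower_expectation_def one_ereal_def)
qed

end

theorem theorem2:
  fixes \<E> :: "nat \<Rightarrow> ('x \<Rightarrow> ereal) \<Rightarrow> ereal"
    and \<xi> :: "'x stream \<Rightarrow> ereal"
  assumes "\<And>n. n \<ge> 1 \<Longrightarrow> outer_prob_content (\<E> n)"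
    and "\<And>\<omega>. \<xi> \<omega> > -\<infinity>"
    and "bounded_below \<xi>"
  shows "almost_all \<E> (\<lambda>\<omega>. liminf (\<lambda>n. upper_expectation \<E> \<xi> (stake n \<omega>)) \<ge> \<xi> \<omega>)"
proof -
  interpret outer_contents \<E>
    by unfold_locales (rule assms(1))
  obtain c where c: "ereal c < (INF \<omega>. \<xi> \<omega>)"
    using assms(3) ereal_dense2[of "-\<infinity>"] unfolding bounded_below_def by auto
  then have bound: "ereal c \<le> \<xi> \<omega>" for \<omega>
    by (meson INF_lower UNIV_I less_imp_le order_trans)
  let ?L = "\<lambda>\<omega>. liminf (\<lambda>n. upper_expectation \<E> \<xi> (stake n \<omega>))"
  \<comment> \<open>Unsuitable pairs get the empty set, so that every member of the enumeration by
    \<open>from_nat\<close> is late null.\<close>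
  define G where "G = (\<lambda>(p, q). if c < real_of_rat p \<and> real_of_rat p < real_of_rat q
    then {\<omega>. ?L \<omega> < ereal (real_of_rat p) \<and> ereal (real_of_rat q) < \<xi> \<omega>} else {})"
  show ?thesis
  proof (rule almost_all_if_late_null_UN)
    show "late_null (G (from_nat i))" for i
      by (simp add: G_def late_null_empty late_null_gap[OF bound] split: prod.split)
    fix \<omega>
    assume "\<not> \<xi> \<omega> \<le> ?L \<omega>"
    then obtain p where p: "?L \<omega> < ereal (real_of_rat p)" "ereal (real_of_rat p) < \<xi> \<omega>"
      using ereal_dense3[of "?L \<omega>" "\<xi> \<omega>"] by (meson not_le)
    then obtain q where q: "ereal (real_of_rat p) < ereal (real_of_rat q)" "ereal (real_of_rat q) < \<xi> \<omega>"
      using ereal_dense3[of "ereal (real_of_rat p)" "\<xi> \<omega>"] by auto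
    \<comment> \<open>This forces \<open>p\<close> above \<open>c\<close>, so \<open>(p, q)\<close>
      is not one of the pairs assigned the empty set.\<close>
    have "ereal c \<le> ?L \<omega>"
      by (rule Liminf_bounded) (simp add: upper_expectation_ge bound)
    also note p(1)
    finally have "ereal c < ereal (real_of_rat p)" .
    with p q have "\<omega> \<in> G (p, q)"
      by (simp add: G_def)
    then show "\<omega> \<in> (\<Union>i. G (from_nat i))"
      by (metis UN_I UNIV_I from_nat_to_nat)
  qed
qed

end
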